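(* Let $(P,M,G)$ be a principal bundle with structure Lie group $G$, projection $\pi:P\to M$ and principal right action $P\times G\to P$, $(p,g)\mapsto a_g(p)$. Then $(P,M,G)$ is canonically associated with a semiheap bundle $(P,M,S_G)$: with the same projection $\pi$ and the action of $S_G$ on $P$ given by $p\triangleleft(g_1,g_2):=a_{g_1^{-1}g_2}(p)$, the triple $(P,M,S_G)$ is a semiheap bundle.
   Context: All manifolds are real, finite dimensional, Hausdorff, second countable smooth manifolds. A Lie semiheap is a smooth manifold $S$ with a smooth map $\mu:S^3\to S$, $\mu(x,y,z)=[x,y,z]$, satisfying $[[x_1,x_2,x_3],x_4,x_5]=[x_1,[x_4,x_3,x_2],x_5]=[x_1,x_2,[x_3,x_4,x_5]]$ for all $x_i\in S$. For a Lie group $G$, $S_G$ denotes the manifold $G$ with ternary operation $[g_1,g_2,g_3]:=g_1g_2^{-1}g_3$, which is a Lie semiheap. A right action of a Lie semiheap $S$ on a manifold $N$ is a smooth map $N\times S\times S\to N$, $(n,x,y)\mapsto n\triangleleft(x,y)$, such that $(n\triangleleft(x_1,x_2))\triangleleft(x_3,x_4)=n\triangleleft(x_1,[x_2,x_3,x_4])$; then $N$ is called an $S$-space. A smooth map $\psi:N\to N'$ of $S$-spaces is $S$-equivariant if $\psi(n\triangleleft(x,y))=\psi(n)\triangleleft(x,y)$. A semiheap bundle $(P,M,S)$ consists of: (1) an $S$-space $P$; (2) a surjective submersion $\pi:P\to M$ such that the action of $S$ on $M$ is trivial, i.e. $\pi(p\triangleleft(x,y))=\pi(p)$ for all $p\in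 P$, $x,y\in S$; (3) an open cover $\{U_i\}_{i\in\mathcal I}$ of $M$ and $S$-equivariant diffeomorphisms $t_i:\pi^{-1}(U_i)\to U_i\times S$ with $\mathrm{prj}_1\circ t_i=\pi$, where the action on $U_i\times S$ is right translation, $(m,x)\triangleleft(x_1,x_2)=(m,[x,x_1,x_2])$. *)

theory Defs
  imports "HOL-Analysis.Analysis" "HOL-Algebra.Group"
begin

text \<open>
  Model spaces. The axiom is that of \<^class>\<open>euclidean_space\<close> without the requirement that the
  basis be nonempty: dimension 0 has to be allowed, since discrete groups are Lie groups.
  The type \<open>origin\<close> below is a model space of dimension 0.
\<close>

class finite_dim_inner = real_inner +
  assumes ex_orthonormal_basis:
    "\<exists>B. finite B \<and> (\<forall>u\<in>B. \<forall>v\<in>B. inner u v = (if u = v then 1 else 0)) \<and>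
         (\<forall>x. (\<forall>u\<in>B. inner x u = 0) \<longrightarrow> x = 0)"

instance euclidean_space \<subseteq> finite_dim_inner
proof (intro_classes)
  show "\<exists>B::'a set. finite B \<and> (\<forall>u\<in>B. \<forall>v\<in>B. inner u v = (if u = v then 1 else 0)) \<and>
         (\<forall>x. (\<forall>u\<in>B. inner x u = 0) \<longrightarrow> x = 0)"
    by (rule exI[of _ Basis]) (auto simp: inner_Basis euclidean_all_zero_iff)
qed

instance prod :: (finite_dim_inner, finite_dim_inner) finite_dim_inner
proof (intro_classes)
  obtain B :: "'a set" where B: "finite B" "\<forall>u\<in>B. \<forall>v\<in>B. inner u v = (if u = v then 1 else 0)"
    "\<forall>x. (\<forall>u\<in>B. inner x u = 0) \<longrightarrow> x = 0"
    using ex_orthonormal_basis[where 'a='a] by (elim exE conjE) (rule that)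
  obtain C :: "'b set" where C: "finite C" "\<forall>u\<in>C. \<forall>v\<in>C. inner u v = (if u = v then 1 else 0)"
    "\<forall>x. (\<forall>u\<in>C. inner x u = 0) \<longrightarrow> x = 0"
    using ex_orthonormal_basis[where 'a='b] by (elim exE conjE) (rule that)
  have B0: "0 \<notin> B" and C0: "0 \<notin> C"
    by (metis B(2) inner_zero_left zero_neq_one) (metis C(2) inner_zero_left zero_neq_one)
  show "\<exists>B::('a \<times> 'b) set. finite B \<and> (\<forall>u\<in>B. \<forall>v\<in>B. inner u v = (if u = v then 1 else 0)) \<and>
         (\<forall>x. (\<forall>u\<in>B. inner x u = 0) \<longrightarrow> x = 0)"
  proof (rule exI[of _ "(\<lambda>b. (b, 0)) ` B \<union> (\<lambda>c. (0, c)) ` C"], intro conjI)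
    show "finite ((\<lambda>b. (b, 0)) ` B \<union> (\<lambda>c. (0, c)) ` C)"
      using B(1) C(1) by simp
    show "\<forall>u\<in>(\<lambda>b. (b, 0)) ` B \<union> (\<lambda>c. (0, c)) ` C. \<forall>v\<in>(\<lambda>b. (b, 0)) ` B \<union> (\<lambda>c. (0, c)) ` C.
        inner u v = (if u = v then 1 else 0)"
      using B0 C0 by (auto simp: B(2)[rule_format] C(2)[rule_format] split: if_split_asm)
    show "\<forall>x. (\<forall>u\<in>(\<lambda>b. (b, 0)) ` B \<union> (\<lambda>c. (0, c)) ` C. inner x u = 0) \<longrightarrow> x = 0"
      using B(3) C(3) by (simp add: ball_Un prod_eq_iff inner_prod_def)
  qed
qed

datatype origin = Origin

lemma origin_eq: "(x::origin) = y"
  by (cases x; cases y) simp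

instantiation origin :: finite_dim_inner
begin

definition "0 = Origin"
definition "(x::origin) + y = Origin"
definition "(x::origin) - y = Origin"
definition "- (x::origin) = Origin"
definition "(r::real) *\<^sub>R (x::origin) = Origin"
definition "sgn (x::origin) = Origin"
definition "norm (x::origin) = 0"
definition "dist (x::origin) (y::origin) = 0"
definition "inner (x::origin) (y::origin) = 0"
definition [code del]: "(uniformity :: (origin \<times> origin) filter) = (INF e\<in>{0<..}. principal {(x, y). dist x y < e})"
definition [code del]: "open (U :: origin set) = (\<forall>x\<in>U. eventually (\<lambda>(x', y). x' = x \<longrightarrow> y \<in> U) uniformity)"

instance
  apply intro_classes
  apply (rule origin_eq uniformity_origin_def open_origin_def
      | simp add: norm_origin_def dist_origin_def inner_origin_def; fail)+
  by (auto simp: norm_origin_def dist_origin_def inner_origin_def origin_eq[of _ 0])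

end


text \<open>
  \<open>C_on n S f\<close>: the function \<open>f\<close> is of class \<open>C\<^sup>n\<close> on the open set \<open>S\<close>. The derivative is
  tested one direction at a time, which suffices because the domain is finite dimensional.
\<close>

primrec C_on :: "nat \<Rightarrow> 'a::finite_dim_inner set \<Rightarrow> ('a \<Rightarrow> 'b::finite_dim_inner) \<Rightarrow> bool" where
  "C_on 0 S f \<longleftrightarrow> continuous_on S f"
| "C_on (Suc n) S f \<longleftrightarrow> (\<forall>x\<in>S. f differentiable (at x)) \<and>
     (\<forall>v. C_on n S (\<lambda>x. frechet_derivative f (at x) v))"

definition smooth_on :: "'a::finite_dim_inner set \<Rightarrow> ('a \<Rightarrow> 'b::finite_dim_inner) \<Rightarrow> bool" where
  "smooth_on S f \<longleftrightarrow> open S \<and> (\<forall>n. C_on n S f)"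


text \<open>
  A manifold is a topology together with an atlas, which need not be maximal. A chart is a pair
  \<open>(U, \<phi>)\<close>; the values of \<open>\<phi>\<close> outside \<open>U\<close> are irrelevant.
\<close>

record ('a, 'e) manifold =
  mtop :: "'a topology"
  atlas :: "('a set \<times> ('a \<Rightarrow> 'e)) set"

abbreviation points :: "('a, 'e, 'z) manifold_scheme \<Rightarrow> 'a set" where
  "points M \<equiv> topspace (mtop M)"

definition smooth_manifold :: "('a, 'e::finite_dim_inner) manifold \<Rightarrow> bool" where
  "smooth_manifold M \<longleftrightarrow>
     Hausdorff_space (mtop M) \<and> second_countable (mtop M) \<and>
     (\<Union>(U, \<phi>)\<in>atlas M. U) = points M \<and>
     (\<forall>(U, \<phi>)\<in>atlas M. openin (mtop M) U \<and> open (\<phi> ` U) \<and>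
        homeomorphic_map (subtopology (mtop M) U) (top_of_set (\<phi> ` U)) \<phi>) \<and>
     (\<forall>(U, \<phi>)\<in>atlas M. \<forall>(V, \<psi>)\<in>atlas M. smooth_on (\<phi> ` (U \<inter> V)) (\<psi> \<circ> inv_into U \<phi>))"

definition smooth_map ::
  "('a, 'e::finite_dim_inner) manifold \<Rightarrow> ('b, 'f::finite_dim_inner) manifold \<Rightarrow> ('a \<Rightarrow> 'b) \<Rightarrow> bool" where
  "smooth_map M N f \<longleftrightarrow>
     continuous_map (mtop M) (mtop N) f \<and>
     (\<forall>(U, \<phi>)\<in>atlas M. \<forall>(V, \<psi>)\<in>atlas N.
        smooth_on (\<phi> ` (U \<inter> f -` V)) (\<psi> \<circ> f \<circ> inv_into U \<phi>))"

definition diffeomorphism ::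
  "('a, 'e::finite_dim_inner) manifold \<Rightarrow> ('b, 'f::finite_dim_inner) manifold \<Rightarrow> ('a \<Rightarrow> 'b) \<Rightarrow> bool" where
  "diffeomorphism M N f \<longleftrightarrow>
     smooth_map M N f \<and> bij_betw f (points M) (points N) \<and>
     smooth_map N M (inv_into (points M) f)"

definition submersion ::
  "('a, 'e::finite_dim_inner) manifold \<Rightarrow> ('b, 'f::finite_dim_inner) manifold \<Rightarrow> ('a \<Rightarrow> 'b) \<Rightarrow> bool" where
  "submersion M N f \<longleftrightarrow>
     smooth_map M N f \<and>
     (\<forall>p\<in>points M. \<forall>(U, \<phi>)\<in>atlas M. \<forall>(V, \<psi>)\<in>atlas N. p \<in> U \<longrightarrow> f p \<in> V \<longrightarrow>
        surj (frechet_derivative (\<psi> \<circ> f \<circ> inv_into U \<phi>) (at (\<phi> p))))"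

definition prod_manifold ::
  "('a, 'e::finite_dim_inner) manifold \<Rightarrow> ('b, 'f::finite_dim_inner) manifold \<Rightarrow> ('a \<times> 'b, 'e \<times> 'f) manifold"
  (infixr \<open>\<times>\<^sub>M\<close> 80) where
  "M \<times>\<^sub>M N = \<lparr>mtop = prod_topology (mtop M) (mtop N),
              atlas = {(U \<times> V, map_prod \<phi> \<psi>) | U \<phi> V \<psi>. (U, \<phi>) \<in> atlas M \<and> (V, \<psi>) \<in> atlas N}\<rparr>"

definition open_submanifold :: "('a, 'e) manifold \<Rightarrow> 'a set \<Rightarrow> ('a, 'e) manifold" where
  "open_submanifold M W = \<lparr>mtop = subtopology (mtop M) W,
                           atlas = {(U \<inter> W, \<phi>) | U \<phi>. (U, \<phi>) \<in> atlas M}\<rparr>"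


definition lie_group :: "('g, 'z) monoid_scheme \<Rightarrow> ('g, 'e::finite_dim_inner) manifold \<Rightarrow> bool" where
  "lie_group G L \<longleftrightarrow>
     group G \<and> smooth_manifold L \<and> points L = carrier G \<and>
     smooth_map (L \<times>\<^sub>M L) L (\<lambda>(x, y). x \<otimes>\<^bsub>G\<^esub> y) \<and>
     smooth_map L L (\<lambda>x. inv\<^bsub>G\<^esub> x)"

text \<open>Right actions are written \<open>a g p\<close> for \<open>a\<^sub>g(p)\<close>.\<close>

definition group_space ::
  "('g, 'z) monoid_scheme \<Rightarrow> ('g, 'e::finite_dim_inner) manifold \<Rightarrow>
   ('n, 'f::finite_dim_inner) manifold \<Rightarrow> ('g \<Rightarrow> 'n \<Rightarrow> 'n) \<Rightarrow> bool" where
  "group_space G L N a \<longleftrightarrow>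
     lie_group G L \<and> smooth_manifold N \<and>
     smooth_map (N \<times>\<^sub>M L) N (\<lambda>(n, g). a g n) \<and>
     (\<forall>n\<in>points N. a \<one>\<^bsub>G\<^esub> n = n) \<and>
     (\<forall>n\<in>points N. \<forall>g\<in>carrier G. \<forall>h\<in>carrier G. a h (a g n) = a (g \<otimes>\<^bsub>G\<^esub> h) n)"

definition group_equivariant ::
  "('g, 'z) monoid_scheme \<Rightarrow>
   ('n, 'e::finite_dim_inner) manifold \<Rightarrow> ('g \<Rightarrow> 'n \<Rightarrow> 'n) \<Rightarrow>
   ('k, 'f::finite_dim_inner) manifold \<Rightarrow> ('g \<Rightarrow> 'k \<Rightarrow> 'k) \<Rightarrow> ('n \<Rightarrow> 'k) \<Rightarrow> bool" where
  "group_equivariant G N a N' a' \<psi> \<longleftrightarrow>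
     smooth_map N N' \<psi> \<and> (\<forall>n\<in>points N. \<forall>g\<in>carrier G. \<psi> (a g n) = a' g (\<psi> n))"

text \<open>
  Freeness of the action and its transitivity on the fibres follow from the equivariant local
  trivialisations.
\<close>

definition principal_bundle ::
  "('p, 'e::finite_dim_inner) manifold \<Rightarrow> ('m, 'f::finite_dim_inner) manifold \<Rightarrow>
   ('g, 'z) monoid_scheme \<Rightarrow> ('g, 'h::finite_dim_inner) manifold \<Rightarrow>
   ('p \<Rightarrow> 'm) \<Rightarrow> ('g \<Rightarrow> 'p \<Rightarrow> 'p) \<Rightarrow> bool" where
  "principal_bundle P M G L \<pi> a \<longleftrightarrow>
     group_space G L P a \<and> smooth_manifold M \<and>
     submersion P M \<pi> \<and> \<pi> ` points P = points M \<and>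
     (\<forall>p\<in>points P. \<forall>g\<in>carrier G. \<pi> (a g p) = \<pi> p) \<and>
     (\<exists>T. (\<Union>(U, t)\<in>T. U) = points M \<and>
        (\<forall>(U, t)\<in>T. openin (mtop M) U \<and>
           (let PU = open_submanifold P (points P \<inter> \<pi> -` U);
                UG = open_submanifold M U \<times>\<^sub>M L
            in diffeomorphism PU UG t \<and>
               group_equivariant G PU a UG (\<lambda>g (m, x). (m, x \<otimes>\<^bsub>G\<^esub> g)) t \<and>
               (\<forall>p\<in>points PU. fst (t p) = \<pi> p))))"


definition lie_semiheap :: "('s, 'e::finite_dim_inner) manifold \<Rightarrow> ('s \<Rightarrow> 's \<Rightarrow> 's \<Rightarrow> 's) \<Rightarrow> bool" where
  "lie_semiheap S \<mu> \<longleftrightarrow>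
     smooth_manifold S \<and>
     smooth_map (S \<times>\<^sub>M S \<times>\<^sub>M S) S (\<lambda>(x, y, z). \<mu> x y z) \<and>
     (\<forall>x1\<in>points S. \<forall>x2\<in>points S. \<forall>x3\<in>points S. \<forall>x4\<in>points S. \<forall>x5\<in>points S.
        \<mu> (\<mu> x1 x2 x3) x4 x5 = \<mu> x1 (\<mu> x4 x3 x2) x5 \<and>
        \<mu> x1 (\<mu> x4 x3 x2) x5 = \<mu> x1 x2 (\<mu> x3 x4 x5))"

definition semiheap_space ::
  "('s, 'e::finite_dim_inner) manifold \<Rightarrow> ('s \<Rightarrow> 's \<Rightarrow> 's \<Rightarrow> 's) \<Rightarrow>
   ('n, 'f::finite_dim_inner) manifold \<Rightarrow> ('n \<Rightarrow> 's \<Rightarrow> 's \<Rightarrow> 'n) \<Rightarrow> bool" where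
  "semiheap_space S \<mu> N act \<longleftrightarrow>
     lie_semiheap S \<mu> \<and> smooth_manifold N \<and>
     smooth_map (N \<times>\<^sub>M S \<times>\<^sub>M S) N (\<lambda>(n, x, y). act n x y) \<and>
     (\<forall>n\<in>points N. \<forall>x1\<in>points S. \<forall>x2\<in>points S. \<forall>x3\<in>points S. \<forall>x4\<in>points S.
        act (act n x1 x2) x3 x4 = act n x1 (\<mu> x2 x3 x4))"

definition semiheap_equivariant ::
  "('s, 'h) manifold \<Rightarrow>
   ('n, 'e::finite_dim_inner) manifold \<Rightarrow> ('n \<Rightarrow> 's \<Rightarrow> 's \<Rightarrow> 'n) \<Rightarrow>
   ('k, 'f::finite_dim_inner) manifold \<Rightarrow> ('k \<Rightarrow> 's \<Rightarrow> 's \<Rightarrow> 'k) \<Rightarrow> ('n \<Rightarrow> 'k) \<Rightarrow> bool" where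
  "semiheap_equivariant S N act N' act' \<psi> \<longleftrightarrow>
     smooth_map N N' \<psi> \<and>
     (\<forall>n\<in>points N. \<forall>x\<in>points S. \<forall>y\<in>points S. \<psi> (act n x y) = act' (\<psi> n) x y)"

definition semiheap_bundle ::
  "('p, 'e::finite_dim_inner) manifold \<Rightarrow> ('m, 'f::finite_dim_inner) manifold \<Rightarrow>
   ('s, 'h::finite_dim_inner) manifold \<Rightarrow> ('s \<Rightarrow> 's \<Rightarrow> 's \<Rightarrow> 's) \<Rightarrow>
   ('p \<Rightarrow> 'm) \<Rightarrow> ('p \<Rightarrow> 's \<Rightarrow> 's \<Rightarrow> 'p) \<Rightarrow> bool" where
  "semiheap_bundle P M S \<mu> \<pi> act \<longleftrightarrow>
     semiheap_space S \<mu> P act \<and> smooth_manifold M \<and>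
     submersion P M \<pi> \<and> \<pi> ` points P = points M \<and>
     (\<forall>p\<in>points P. \<forall>x\<in>points S. \<forall>y\<in>points S. \<pi> (act p x y) = \<pi> p) \<and>
     (\<exists>T. (\<Union>(U, t)\<in>T. U) = points M \<and>
        (\<forall>(U, t)\<in>T. openin (mtop M) U \<and>
           (let PU = open_submanifold P (points P \<inter> \<pi> -` U);
                US = open_submanifold M U \<times>\<^sub>M S
            in diffeomorphism PU US t \<and>
               semiheap_equivariant S PU act US (\<lambda>(m, x) x1 x2. (m, \<mu> x x1 x2)) t \<and>
               (\<forall>p\<in>points PU. fst (t p) = \<pi> p))))"

definition group_bracket :: "('g, 'z) monoid_scheme \<Rightarrow> 'g \<Rightarrow> 'g \<Rightarrow> 'g \<Rightarrow> 'g" where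
  "group_bracket G g1 g2 g3 = g1 \<otimes>\<^bsub>G\<^esub> inv\<^bsub>G\<^esub> g2 \<otimes>\<^bsub>G\<^esub> g3"

end

theory Submission
  imports Defs
begin

text \<open>
  Algebraically everything is forced by \<open>a\<^sub>h \<circ> a\<^sub>g = a\<^sub>g\<^sub>h\<close>: with \<open>g = x\<^sup>-\<^sup>1y\<close>,
  equivariance of a trivialisation reads \<open>t (p \<triangleleft> (x, y)) = (m, z (x\<^sup>-\<^sup>1y)) = (m, [z, x, y])\<close>, so the
  trivialisations of the principal bundle serve unchanged. The analytic content is that the bracket
  and the action are composites of smooth maps into products, so smooth maps have to be closed
  under composition and pairing, and products of manifolds have to be manifolds.
\<close>

section \<open>Functions of class \<open>C\<^sup>n\<close>\<close>

text \<open>A derivative at a point of an open set sees only nearby values, so both functions have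
  the same derivative throughout \<open>S\<close>. The induction generalises \<open>f\<close> and
  \<open>g\<close> because its step passes to their directional derivatives.\<close>

lemma C_on_cong:
  assumes "open S" "\<And>x. x \<in> S \<Longrightarrow> f x = g x" "C_on n S f"
  shows "C_on n S g"
  using assms(2,3)
proof (induction n arbitrary: f g)
  case 0
  then show ?case by (simp cong: continuous_on_cong)
next
  case (Suc n)
  have df: "f differentiable (at x)" if "x \<in> S" for x
    using Suc.prems(2) that by simp
  have dg: "g differentiable (at x)" if "x \<in> S" for x
    using df[OF that] has_derivative_transform_within_open[where f = f and g = g, OF _ assms(1) that]
      Suc.prems(1) unfolding differentiable_def by blast
  have eq: "frechet_derivative f (at x) = frechet_derivative g (at x)" if "x \<in> S" for x
    by (rule frechet_derivative_transform_within_open[OF df[OF that] assms(1) that Suc.prems(1)])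
  have "C_on n S (\<lambda>x. frechet_derivative g (at x) v)" for v
    by (rule Suc.IH[of "\<lambda>x. frechet_derivative f (at x) v"]) (use Suc.prems(2) eq in auto)
  then show ?case using dg by simp
qed

text \<open>Uniqueness of the derivative lets an explicit formula \<open>f'\<close> replace the
  chosen \<open>frechet_derivative\<close>. The closure properties below obtain their derivative
  formulas from the library and feed them in here.\<close>

lemma C_on_SucI:
  assumes "open S" "\<And>x. x \<in> S \<Longrightarrow> (f has_derivative f' x) (at x)"
    "\<And>v. C_on n S (\<lambda>x. f' x v)"
  shows "C_on (Suc n) S f"
proof -
  have "C_on n S (\<lambda>x. frechet_derivative f (at x) v)" for v
    by (rule C_on_cong[OF assms(1) _ assms(3)[of v]])
       (simp flip: frechet_derivative_at[OF assms(2)])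
  then show ?thesis
    using assms(2) by (auto simp: differentiable_def)
qed

lemma C_on_Suc_D:
  assumes "C_on (Suc n) S f"
  shows "\<And>x. x \<in> S \<Longrightarrow> (f has_derivative frechet_derivative f (at x)) (at x)"
    and "\<And>v. C_on n S (\<lambda>x. frechet_derivative f (at x) v)"
  using assms by (auto simp: frechet_derivative_works)

text \<open>Differentiability gives continuity at the bottom level, and each further level is
  inherited from the directional derivatives. The product and chain rules need this for the factors
  that are left undifferentiated.\<close>

lemma C_on_pred: "C_on (Suc n) S f \<Longrightarrow> C_on n S f"
proof (induction n arbitrary: f)
  case 0
  then show ?case
    by (auto intro!: continuous_at_imp_continuous_on differentiable_imp_continuous_within)
next
  case (Suc n)
  have "f differentiable (at x)" if "x \<in> S" for x
    using Suc.prems that by simp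
  moreover have "C_on n S (\<lambda>x. frechet_derivative f (at x) v)" for v
    by (rule Suc.IH) (rule C_on_Suc_D(2)[OF Suc.prems])
  ultimately show ?case by simp
qed

lemma C_on_subset: "C_on n S f \<Longrightarrow> T \<subseteq> S \<Longrightarrow> C_on n T f"
  by (induction n arbitrary: f) (auto intro: continuous_on_subset)

text \<open>Continuity and differentiability at a point are decided in a neighbourhood, and the same
  \<open>A\<close> serves for every directional derivative. This later allows the chart of an
  intermediate manifold to vary from point to point.\<close>

lemma C_on_local:
  assumes "\<And>x. x \<in> S \<Longrightarrow> \<exists>A. open A \<and> x \<in> A \<and> C_on n A f"
  shows "C_on n S f"
  using assms
proof (induction n arbitrary: f)
  case 0
  have "isCont f x" if "x \<in> S" for x
    using "0"[OF that] continuous_on_eq_continuous_at by auto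
  then show ?case by (simp add: continuous_at_imp_continuous_on)
next
  case (Suc n)
  have "C_on n S (\<lambda>x. frechet_derivative f (at x) v)" for v
    by (rule Suc.IH) (use Suc.prems in fastforce)
  moreover have "f differentiable (at x)" if "x \<in> S" for x
    using Suc.prems[OF that] by auto
  ultimately show ?case by simp
qed

section \<open>Closure of the class C^n under linear maps, sums, products, pairing and
  composition\<close>

lemma C_on_const: "C_on n S (\<lambda>_. c)"
  by (induction n arbitrary: c) simp_all

text \<open>The directional derivative of \<open>h\<close> after \<open>f\<close> is
  \<open>h\<close> after that of \<open>f\<close>, an expression of the same shape, to which the
  induction hypothesis applies.\<close>

lemma C_on_bounded_linear_compose:
  assumes "open S" "bounded_linear h" "C_on n S f"
  shows "C_on n S (\<lambda>x. h (f x))"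
  using assms(3)
proof (induction n arbitrary: f)
  case 0
  then show ?case by (simp add: bounded_linear.continuous_on[OF assms(2)])
next
  case (Suc n)
  show ?case
    by (rule C_on_SucI[OF assms(1)
          bounded_linear.has_derivative[OF assms(2) C_on_Suc_D(1)[OF Suc.prems]]])
       (auto intro: Suc.IH C_on_Suc_D(2)[OF Suc.prems])
qed

lemma C_on_add:
  assumes "open S" "C_on n S f" "C_on n S g"
  shows "C_on n S (\<lambda>x. f x + g x)"
  using assms(2,3)
proof (induction n arbitrary: f g)
  case 0
  then show ?case by (simp add: continuous_on_add)
next
  case (Suc n)
  show ?case
    by (rule C_on_SucI[OF assms(1)
          has_derivative_add[OF C_on_Suc_D(1)[OF Suc.prems(1)] C_on_Suc_D(1)[OF Suc.prems(2)]]])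
       (auto intro: Suc.IH C_on_Suc_D(2)[OF Suc.prems(1)] C_on_Suc_D(2)[OF Suc.prems(2)])
qed

lemma C_on_sum:
  assumes "open S" "\<And>i. i \<in> I \<Longrightarrow> C_on n S (f i)"
  shows "C_on n S (\<lambda>x. \<Sum>i\<in>I. f i x)"
  using assms(2)
  by (induction I rule: infinite_finite_induct) (auto intro: C_on_const C_on_add[OF assms(1)])

text \<open>By the Leibniz rule the derivative is a sum of two products, each of one function with a
  directional derivative of the other. All these factors are of class C^n, so the induction
  hypothesis covers both summands.\<close>

lemma C_on_scaleR:
  fixes f :: "'a::finite_dim_inner \<Rightarrow> real"
  assumes "open S" "C_on n S f" "C_on n S g"
  shows "C_on n S (\<lambda>x. f x *\<^sub>R g x)"
  using assms(2,3)
proof (induction n arbitrary: f g)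
  case 0
  then show ?case by (simp add: continuous_on_scaleR)
next
  case (Suc n)
  show ?case
    by (rule C_on_SucI[OF assms(1)
          has_derivative_scaleR[OF C_on_Suc_D(1)[OF Suc.prems(1)] C_on_Suc_D(1)[OF Suc.prems(2)]]])
       (auto intro!: C_on_add[OF assms(1)] Suc.IH C_on_pred[OF Suc.prems(1)]
          C_on_pred[OF Suc.prems(2)] C_on_Suc_D(2)[OF Suc.prems(1)] C_on_Suc_D(2)[OF Suc.prems(2)])
qed

lemma C_on_Pair:
  assumes "open S" "C_on n S f" "C_on n S g"
  shows "C_on n S (\<lambda>x. (f x, g x))"
  using assms(2,3)
proof (induction n arbitrary: f g)
  case 0
  then show ?case by (simp add: continuous_on_Pair)
next
  case (Suc n)
  show ?case
    by (rule C_on_SucI[OF assms(1)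
          has_derivative_Pair[OF C_on_Suc_D(1)[OF Suc.prems(1)] C_on_Suc_D(1)[OF Suc.prems(2)]]])
       (auto intro: Suc.IH C_on_Suc_D(2)[OF Suc.prems(1)] C_on_Suc_D(2)[OF Suc.prems(2)])
qed

text \<open>The difference of \<open>x\<close> and its expansion is orthogonal to every element of
  \<open>B\<close>, hence zero by the completeness clause of the class axiom.\<close>

lemma orthonormal_expansion:
  obtains B :: "'a::finite_dim_inner set" where "finite B" "\<And>x. x = (\<Sum>b\<in>B. inner x b *\<^sub>R b)"
proof -
  obtain B :: "'a set" where B: "finite B" "\<forall>u\<in>B. \<forall>v\<in>B. inner u v = (if u = v then 1 else 0)"
    "\<forall>x. (\<forall>u\<in>B. inner x u = 0) \<longrightarrow> x = 0"
    using ex_orthonormal_basis[where 'a='a] by (elim exE conjE) (rule that)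
  have "x = (\<Sum>b\<in>B. inner x b *\<^sub>R b)" for x
  proof -
    have "inner (x - (\<Sum>b\<in>B. inner x b *\<^sub>R b)) u = 0" if "u \<in> B" for u
    proof -
      have "(\<Sum>b\<in>B. inner x b * inner b u) = (\<Sum>b\<in>B. if b = u then inner x b else 0)"
        by (rule sum.cong) (use B(2) that in auto)
      also have "\<dots> = inner x u" using B(1) that by (simp add: sum.delta)
      finally show ?thesis by (simp add: inner_diff_left inner_sum_left)
    qed
    then show ?thesis using B(3) by fastforce
  qed
  then show ?thesis using B(1) that by blast
qed

text \<open>Induction with \<open>f\<close> fixed and \<open>g\<close> varying: after the chain
  rule, the functions composed with \<open>f\<close> are directional derivatives of
  \<open>g\<close>.\<close>

lemma C_on_compose:
  fixes f :: "'a::finite_dim_inner \<Rightarrow> 'b::finite_dim_inner"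
    and g :: "'b \<Rightarrow> 'c::finite_dim_inner"
  assumes "open S" "f ` S \<subseteq> T" "C_on n S f" "C_on n T g"
  shows "C_on n S (\<lambda>x. g (f x))"
  using assms(3,4)
proof (induction n arbitrary: g)
  case 0
  then show ?case using assms(2) by (auto intro: continuous_on_compose2)
next
  case (Suc n)
  obtain B :: "'b set" where B: "finite B" "\<And>y. y = (\<Sum>b\<in>B. inner y b *\<^sub>R b)"
    by (rule orthonormal_expansion) (rule that)
  let ?f' = "\<lambda>x. frechet_derivative f (at x)"
  let ?g' = "\<lambda>x. frechet_derivative g (at (f x))"
  have fT: "f x \<in> T" if "x \<in> S" for x
    using assms(2) that by blast
  have dg: "(g has_derivative ?g' x) (at (f x))" if "x \<in> S" for x
    using C_on_Suc_D(1)[OF Suc.prems(2) fT[OF that]] .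
  have der: "((\<lambda>x. g (f x)) has_derivative (\<lambda>v. ?g' x (?f' x v))) (at x)" if "x \<in> S" for x
    by (rule has_derivative_compose[OF C_on_Suc_D(1)[OF Suc.prems(1) that] dg[OF that]])
  \<comment> \<open>\<^const>\<open>C_on\<close> only controls the partial map \<open>x \<mapsto> ?g' x b\<close> for a fixed direction \<open>b\<close>, hence the
    expansion in an orthonormal basis.\<close>
  have expand: "(\<Sum>b\<in>B. inner (?f' x v) b *\<^sub>R ?g' x b) = ?g' x (?f' x v)" if "x \<in> S" for x v
  proof -
    interpret g': bounded_linear "?g' x"
      by (rule has_derivative_bounded_linear[OF dg[OF that]])
    have "?g' x (?f' x v) = ?g' x (\<Sum>b\<in>B. inner (?f' x v) b *\<^sub>R b)"
      using B(2)[of "?f' x v"] by simp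
    then show ?thesis by (simp add: g'.sum g'.scaleR)
  qed
  \<comment> \<open>The scalar coefficients are components of a directional derivative of
    \<open>f\<close>; the vectors are directional derivatives of \<open>g\<close> in the constant
    directions \<open>b\<close>, composed with \<open>f\<close>, so the induction hypothesis handles
    them.\<close>
  have sum: "C_on n S (\<lambda>x. \<Sum>b\<in>B. inner (?f' x v) b *\<^sub>R ?g' x b)" for v
    by (intro C_on_sum C_on_scaleR assms(1) C_on_bounded_linear_compose[OF _ bounded_linear_inner_left]
        C_on_Suc_D(2)[OF Suc.prems(1)] Suc.IH[OF C_on_pred[OF Suc.prems(1)]] C_on_Suc_D(2)[OF Suc.prems(2)])
  have "C_on n S (\<lambda>x. ?g' x (?f' x v))" for v
    by (rule C_on_cong[OF assms(1) _ sum]) (rule expand)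
  with der show ?case by (rule C_on_SucI[OF assms(1)])
qed


section \<open>Smooth functions on open sets\<close>

lemma smooth_on_open: "smooth_on S f \<Longrightarrow> open S"
  by (simp add: smooth_on_def)

lemma smooth_on_subset: "smooth_on S f \<Longrightarrow> open T \<Longrightarrow> T \<subseteq> S \<Longrightarrow> smooth_on T f"
  by (auto simp: smooth_on_def intro: C_on_subset)

lemma smooth_on_cong: "smooth_on S f \<Longrightarrow> (\<And>x. x \<in> S \<Longrightarrow> f x = g x) \<Longrightarrow> smooth_on S g"
  by (auto simp: smooth_on_def intro: C_on_cong)

text \<open>Since \<open>smooth_on\<close> includes openness, the inclusion
  \<open>A \<subseteq> S\<close> is demanded: it exhibits \<open>S\<close> as a union of open
  sets.\<close>

lemma smooth_on_local:
  assumes "\<And>x. x \<in> S \<Longrightarrow> \<exists>A. x \<in> A \<and> A \<subseteq> S \<and> smooth_on A f"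
  shows "smooth_on S f"
  unfolding smooth_on_def
proof (intro conjI allI)
  show "open S"
    unfolding open_subopen[of S] using assms smooth_on_open by meson
  show "C_on n S f" for n
    using assms unfolding smooth_on_def by (intro C_on_local) blast
qed

lemma smooth_on_compose:
  "smooth_on S f \<Longrightarrow> smooth_on T g \<Longrightarrow> f ` S \<subseteq> T \<Longrightarrow> smooth_on S (\<lambda>x. g (f x))"
  by (auto simp: smooth_on_def intro: C_on_compose[where T = T])

lemma smooth_on_Pair: "smooth_on S f \<Longrightarrow> smooth_on S g \<Longrightarrow> smooth_on S (\<lambda>x. (f x, g x))"
  by (auto simp: smooth_on_def intro: C_on_Pair)

text \<open>A bounded linear map is its own derivative everywhere, so its directional derivatives
  are constant. The instances used are the projections \<open>fst\<close> and
  \<open>snd\<close>.\<close>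

lemma smooth_on_bounded_linear:
  assumes "open S" "bounded_linear f"
  shows "smooth_on S f"
proof -
  have "C_on n S f" for n
  proof (cases n)
    case 0
    then show ?thesis
      using assms(2) by (simp add: linear_continuous_on)
  next
    case (Suc m)
    have "C_on (Suc m) S f"
      by (rule C_on_SucI[OF assms(1) bounded_linear_imp_has_derivative[OF assms(2)] C_on_const])
    then show ?thesis using Suc by simp
  qed
  then show ?thesis using assms(1) by (simp add: smooth_on_def)
qed


section \<open>Smooth maps and product manifolds\<close>

lemma
  assumes "smooth_manifold M" "(U, \<phi>) \<in> atlas M"
  shows chart_openin: "openin (mtop M) U"
    and chart_subset: "U \<subseteq> points M"
    and chart_open_image: "open (\<phi> ` U)"
    and chart_homeomorphic: "homeomorphic_map (subtopology (mtop M) U) (top_of_set (\<phi> ` U)) \<phi>"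
    and chart_inj: "inj_on \<phi> U"
proof -
  show o: "openin (mtop M) U" and oi: "open (\<phi> ` U)"
    and h: "homeomorphic_map (subtopology (mtop M) U) (top_of_set (\<phi> ` U)) \<phi>"
    using assms by (auto simp: smooth_manifold_def)
  show s: "U \<subseteq> points M" using o by (rule openin_subset)
  show "inj_on \<phi> U"
    using homeomorphic_imp_injective_map[OF h] s by (simp add: inf.absorb2)
qed

lemma chart_transition_smooth:
  "smooth_manifold M \<Longrightarrow> (U, \<phi>) \<in> atlas M \<Longrightarrow> (V, \<psi>) \<in> atlas M \<Longrightarrow>
    smooth_on (\<phi> ` (U \<inter> V)) (\<psi> \<circ> inv_into U \<phi>)"
  unfolding smooth_manifold_def by fast

lemma charts_cover: "smooth_manifold M \<Longrightarrow> (\<Union>(U, \<phi>)\<in>atlas M. U) = points M"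
  by (simp add: smooth_manifold_def)

lemma ex_chart:
  assumes "smooth_manifold M" "p \<in> points M"
  obtains U \<phi> where "(U, \<phi>) \<in> atlas M" "p \<in> U"
proof -
  have "p \<in> (\<Union>(U, \<phi>)\<in>atlas M. U)"
    using assms by (simp only: charts_cover)
  then show ?thesis using that by blast
qed

lemma chart_image_open:
  assumes M: "smooth_manifold M" "(U, \<phi>) \<in> atlas M" and W: "openin (mtop M) W"
  shows "open (\<phi> ` (U \<inter> W))"
proof -
  have "openin (subtopology (mtop M) U) (U \<inter> W)"
    using W by (auto simp: openin_subtopology)
  then have "openin (top_of_set (\<phi> ` U)) (\<phi> ` (U \<inter> W))"
    using homeomorphic_imp_open_map[OF chart_homeomorphic[OF M]] by (simp add: open_map_def)
  then show ?thesis
    using chart_open_image[OF M] by (rule openin_open_trans)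
qed

lemma smooth_map_continuous: "smooth_map M N f \<Longrightarrow> continuous_map (mtop M) (mtop N) f"
  by (simp add: smooth_map_def)

lemma smooth_map_points: "smooth_map M N f \<Longrightarrow> p \<in> points M \<Longrightarrow> f p \<in> points N"
  by (auto simp: smooth_map_def continuous_map_def)

lemma smooth_map_chart:
  "smooth_map M N f \<Longrightarrow> (U, \<phi>) \<in> atlas M \<Longrightarrow> (V, \<psi>) \<in> atlas N \<Longrightarrow>
    smooth_on (\<phi> ` (U \<inter> f -` V)) (\<lambda>x. \<psi> (f (inv_into U \<phi> x)))"
  by (auto simp: smooth_map_def o_def)

lemma smooth_mapI:
  assumes "continuous_map (mtop M) (mtop N) f"
    "\<And>U \<phi> V \<psi>. (U, \<phi>) \<in> atlas M \<Longrightarrow> (V, \<psi>) \<in> atlas N \<Longrightarrow>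
      smooth_on (\<phi> ` (U \<inter> f -` V)) (\<lambda>x. \<psi> (f (inv_into U \<phi> x)))"
  shows "smooth_map M N f"
  using assms by (auto simp: smooth_map_def o_def)

text \<open>Near each point a chart of \<open>N\<close> around the image splits the coordinate
  expression of the composite into those of \<open>f\<close> and \<open>g\<close>. These local
  statements are glued by \<open>smooth_on_local\<close>.\<close>

lemma smooth_map_compose:
  assumes M: "smooth_manifold M" and N: "smooth_manifold N" and K: "smooth_manifold K"
    and f: "smooth_map M N f" and g: "smooth_map N K g"
  shows "smooth_map M K (\<lambda>x. g (f x))"
proof (rule smooth_mapI)
  show cont: "continuous_map (mtop M) (mtop K) (\<lambda>x. g (f x))"
    using continuous_map_compose[OF smooth_map_continuous[OF f] smooth_map_continuous[OF g]]
    by (simp add: o_def)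
  fix U \<phi> W \<theta> assume U: "(U, \<phi>) \<in> atlas M" and W: "(W, \<theta>) \<in> atlas K"
  show "smooth_on (\<phi> ` (U \<inter> (\<lambda>x. g (f x)) -` W)) (\<lambda>x. \<theta> (g (f (inv_into U \<phi> x))))"
  proof (rule smooth_on_local)
    fix x assume "x \<in> \<phi> ` (U \<inter> (\<lambda>x. g (f x)) -` W)"
    then obtain p where p: "x = \<phi> p" "p \<in> U" "g (f p) \<in> W" by auto
    have "f p \<in> points N"
      using smooth_map_points[OF f] chart_subset[OF M U] p(2) by blast
    then obtain V \<psi> where V: "(V, \<psi>) \<in> atlas N" "f p \<in> V"
      using ex_chart[OF N] by metis
    let ?A = "\<phi> ` (U \<inter> (f -` V \<inter> (\<lambda>x. g (f x)) -` W))"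
    \<comment> \<open>Continuity makes preimages open only after intersection with
      \<open>points M\<close>; inside \<open>U\<close> this intersection changes nothing.\<close>
    have "?A = \<phi> ` (U \<inter> ({p \<in> points M. f p \<in> V} \<inter> {p \<in> points M. g (f p) \<in> W}))"
      using chart_subset[OF M U] by blast
    moreover have "openin (mtop M) ({p \<in> points M. f p \<in> V} \<inter> {p \<in> points M. g (f p) \<in> W})"
      using openin_continuous_map_preimage[OF smooth_map_continuous[OF f] chart_openin[OF N V(1)]]
        openin_continuous_map_preimage[OF cont chart_openin[OF K W]] by (rule openin_Int)
    ultimately have A: "open ?A"
      using chart_image_open[OF M U] by simp
    have inv: "inv_into U \<phi> (\<phi> q) = q" if "q \<in> U" for q
      using chart_inj[OF M U] that by simp
    have "smooth_on ?A (\<lambda>x. \<psi> (f (inv_into U \<phi> x)))"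
      by (rule smooth_on_subset[OF smooth_map_chart[OF f U V(1)] A]) auto
    moreover have "(\<lambda>x. \<psi> (f (inv_into U \<phi> x))) ` ?A \<subseteq> \<psi> ` (V \<inter> g -` W)"
      using inv by auto
    ultimately have "smooth_on ?A (\<lambda>x. \<theta> (g (inv_into V \<psi> (\<psi> (f (inv_into U \<phi> x))))))"
      using smooth_on_compose[OF _ smooth_map_chart[OF g V(1) W]] by blast
    \<comment> \<open>On \<open>?A\<close> the map \<open>f\<close> lands in \<open>V\<close>, so
      the inserted \<open>\<psi>\<close> and its inverse cancel.\<close>
    then have "smooth_on ?A (\<lambda>x. \<theta> (g (f (inv_into U \<phi> x))))"
      by (rule smooth_on_cong) (use inv chart_inj[OF N V(1)] in auto)
    then show "\<exists>A. x \<in> A \<and> A \<subseteq> \<phi> ` (U \<inter> (\<lambda>x. g (f x)) -` W) \<and>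
        smooth_on A (\<lambda>x. \<theta> (g (f (inv_into U \<phi> x))))"
      using p V(2) by (intro exI[of _ ?A]) auto
  qed
qed

section \<open>Product manifolds and their universal property\<close>

lemma mtop_prod_manifold [simp]: "mtop (M \<times>\<^sub>M N) = prod_topology (mtop M) (mtop N)"
  by (simp add: prod_manifold_def)

lemma atlas_prod_manifold:
  "atlas (M \<times>\<^sub>M N) =
    {(U \<times> V, map_prod \<phi> \<psi>) | U \<phi> V \<psi>. (U, \<phi>) \<in> atlas M \<and> (V, \<psi>) \<in> atlas N}"
  by (simp add: prod_manifold_def)

text \<open>Injectivity leaves \<open>inv_into\<close> no choice, so the inverse of a product chart
  is computed componentwise.\<close>

lemma inv_into_map_prod:
  assumes "inj_on f A" "inj_on g B" "z \<in> (f ` A) \<times> (g ` B)"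
  shows "inv_into (A \<times> B) (map_prod f g) z = (inv_into A f (fst z), inv_into B g (snd z))"
proof -
  have "inv_into (A \<times> B) (map_prod f g) (map_prod f g (a, b)) = (a, b)" if "a \<in> A" "b \<in> B" for a b
    by (rule inv_into_f_f) (use assms(1,2) that in \<open>auto intro: map_prod_inj_on\<close>)
  then show ?thesis using assms by auto
qed

text \<open>Products of basic sets form a countable base: around each point an open set contains an
  open rectangle, whose sides shrink to basic sets.\<close>

lemma second_countable_prod_topology:
  assumes "second_countable X" "second_countable Y"
  shows "second_countable (prod_topology X Y)"
proof -
  obtain B where B: "countable B" "\<forall>V\<in>B. openin X V"
    "\<forall>U x. openin X U \<and> x \<in> U \<longrightarrow> (\<exists>V\<in>B. x \<in> V \<and> V \<subseteq> U)"
    using assms(1) unfolding second_countable_def by (elim exE conjE) (rule that)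
  obtain C where C: "countable C" "\<forall>V\<in>C. openin Y V"
    "\<forall>U x. openin Y U \<and> x \<in> U \<longrightarrow> (\<exists>V\<in>C. x \<in> V \<and> V \<subseteq> U)"
    using assms(2) unfolding second_countable_def by (elim exE conjE) (rule that)
  show ?thesis
    unfolding second_countable_def
  proof (intro exI[of _ "(\<lambda>(V, W). V \<times> W) ` (B \<times> C)"] conjI ballI allI impI)
    show "countable ((\<lambda>(V, W). V \<times> W) ` (B \<times> C))"
      using B(1) C(1) by simp
    show "openin (prod_topology X Y) V" if "V \<in> (\<lambda>(V, W). V \<times> W) ` (B \<times> C)" for V
      using that B(2) C(2) by (auto simp: openin_prod_Times_iff)
    show "\<exists>V\<in>(\<lambda>(V, W). V \<times> W) ` (B \<times> C). z \<in> V \<and> V \<subseteq> U"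
      if U: "openin (prod_topology X Y) U \<and> z \<in> U" for U z
    proof -
      obtain x y where z: "z = (x, y)" by (cases z)
      obtain V W where VW: "openin X V" "openin Y W" "x \<in> V" "y \<in> W" "V \<times> W \<subseteq> U"
        using U unfolding openin_prod_topology_alt z by blast
      obtain V' where "V' \<in> B" "x \<in> V'" "V' \<subseteq> V"
        using B(3) VW(1,3) by blast
      moreover obtain W' where "W' \<in> C" "y \<in> W'" "W' \<subseteq> W"
        using C(3) VW(2,4) by blast
      ultimately show ?thesis
        using VW(5) unfolding z by (intro bexI[of _ "V' \<times> W'"]) auto
    qed
  qed
qed

lemma homeomorphic_map_map_prod:
  assumes "homeomorphic_map X X' f" "homeomorphic_map Y Y' g"
  shows "homeomorphic_map (prod_topology X Y) (prod_topology X' Y') (map_prod f g)"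
proof -
  obtain f' g' where "homeomorphic_maps X X' f f'" "homeomorphic_maps Y Y' g g'"
    using assms by (auto simp: homeomorphic_map_maps)
  then have "homeomorphic_maps (prod_topology X Y) (prod_topology X' Y')
      (\<lambda>(x, y). (f x, g y)) (\<lambda>(x, y). (f' x, g' y))"
    by (simp add: homeomorphic_maps_prod)
  moreover have "(\<lambda>(x, y). (f x, g y)) = map_prod f g"
    by auto
  ultimately show ?thesis
    by (auto simp: homeomorphic_map_maps)
qed

text \<open>Product charts are homeomorphisms onto open rectangles, and their transition maps are
  products of the transition maps of the factors.\<close>

lemma smooth_manifold_prod:
  assumes M: "smooth_manifold M" and N: "smooth_manifold N"
  shows "smooth_manifold (M \<times>\<^sub>M N)"
  unfolding smooth_manifold_def
proof (intro conjI)
  show "Hausdorff_space (mtop (M \<times>\<^sub>M N))" "second_countable (mtop (M \<times>\<^sub>M N))"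
    using M N
    by (auto simp: smooth_manifold_def Hausdorff_space_prod_topology intro: second_countable_prod_topology)
  show "(\<Union>(U, \<phi>)\<in>atlas (M \<times>\<^sub>M N). U) = points (M \<times>\<^sub>M N)"
  proof (rule Set.set_eqI)
    fix z :: "'a \<times> 'c"
    obtain x y where z: "z = (x, y)" by (cases z)
    have "z \<in> (\<Union>(U, \<phi>)\<in>atlas (M \<times>\<^sub>M N). U) \<longleftrightarrow>
        x \<in> (\<Union>(U, \<phi>)\<in>atlas M. U) \<and> y \<in> (\<Union>(U, \<phi>)\<in>atlas N. U)"
      unfolding z atlas_prod_manifold by auto blast
    then show "z \<in> (\<Union>(U, \<phi>)\<in>atlas (M \<times>\<^sub>M N). U) \<longleftrightarrow> z \<in> points (M \<times>\<^sub>M N)"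
      using charts_cover[OF M] charts_cover[OF N] by (simp only: z) simp
  qed
  have "openin (mtop (M \<times>\<^sub>M N)) (U \<times> V) \<and> open (map_prod \<phi> \<psi> ` (U \<times> V)) \<and>
      homeomorphic_map (subtopology (mtop (M \<times>\<^sub>M N)) (U \<times> V))
        (top_of_set (map_prod \<phi> \<psi> ` (U \<times> V))) (map_prod \<phi> \<psi>)"
    if U: "(U, \<phi>) \<in> atlas M" and V: "(V, \<psi>) \<in> atlas N" for U \<phi> V \<psi>
    using homeomorphic_map_map_prod[OF chart_homeomorphic[OF M U] chart_homeomorphic[OF N V]]
      chart_openin[OF M U] chart_openin[OF N V] chart_open_image[OF M U] chart_open_image[OF N V]
    by (simp add: map_prod_image subtopology_Times openin_prod_Times_iff open_Times)
  then show "\<forall>(U, \<phi>)\<in>atlas (M \<times>\<^sub>M N). openin (mtop (M \<times>\<^sub>M N)) U \<and> open (\<phi> ` U) \<and>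
        homeomorphic_map (subtopology (mtop (M \<times>\<^sub>M N)) U) (top_of_set (\<phi> ` U)) \<phi>"
    unfolding atlas_prod_manifold by blast
  have "smooth_on (map_prod \<phi> \<psi> ` (U \<times> V \<inter> U' \<times> V'))
      (map_prod \<phi>' \<psi>' \<circ> inv_into (U \<times> V) (map_prod \<phi> \<psi>))"
    if U: "(U, \<phi>) \<in> atlas M" and V: "(V, \<psi>) \<in> atlas N"
      and U': "(U', \<phi>') \<in> atlas M" and V': "(V', \<psi>') \<in> atlas N" for U \<phi> V \<psi> U' \<phi>' V' \<psi>'
  proof -
    let ?A = "\<phi> ` (U \<inter> U')" and ?B = "\<psi> ` (V \<inter> V')"
    note s = chart_transition_smooth[OF M U U'] chart_transition_smooth[OF N V V']
    have o: "open (?A \<times> ?B)"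
      using s by (intro open_Times smooth_on_open)
    \<comment> \<open>Each component is a transition map preceded by a linear projection.\<close>
    have "smooth_on (?A \<times> ?B) (\<lambda>z. ((\<phi>' \<circ> inv_into U \<phi>) (fst z), (\<psi>' \<circ> inv_into V \<psi>) (snd z)))"
      by (intro smooth_on_Pair smooth_on_compose[OF smooth_on_bounded_linear[OF o bounded_linear_fst] s(1)]
          smooth_on_compose[OF smooth_on_bounded_linear[OF o bounded_linear_snd] s(2)]) auto
    then have "smooth_on (?A \<times> ?B) (map_prod \<phi>' \<psi>' \<circ> inv_into (U \<times> V) (map_prod \<phi> \<psi>))"
      by (rule smooth_on_cong)
         (subst o_apply, subst inv_into_map_prod[OF chart_inj[OF M U] chart_inj[OF N V]], auto)
    then show ?thesis
      by (simp add: Times_Int_Times map_prod_image)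
  qed
  then show "\<forall>(U, \<phi>)\<in>atlas (M \<times>\<^sub>M N). \<forall>(V, \<psi>)\<in>atlas (M \<times>\<^sub>M N).
      smooth_on (\<phi> ` (U \<inter> V)) (\<psi> \<circ> inv_into U \<phi>)"
    unfolding atlas_prod_manifold by blast
qed

text \<open>In a product chart the coordinate expression is the pair of the two expressions, on the
  intersection of their domains.\<close>

lemma smooth_map_Pair:
  assumes K: "smooth_manifold K" and f: "smooth_map K M f" and g: "smooth_map K N g"
  shows "smooth_map K (M \<times>\<^sub>M N) (\<lambda>x. (f x, g x))"
proof (rule smooth_mapI)
  show "continuous_map (mtop K) (mtop (M \<times>\<^sub>M N)) (\<lambda>x. (f x, g x))"
    using f g by (simp add: continuous_map_pairwise o_def smooth_map_continuous)
  fix W \<theta> Z \<zeta> assume W: "(W, \<theta>) \<in> atlas K" and "(Z, \<zeta>) \<in> atlas (M \<times>\<^sub>M N)"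
  then obtain U \<phi> V \<psi> where Z: "Z = U \<times> V" "\<zeta> = map_prod \<phi> \<psi>"
    and U: "(U, \<phi>) \<in> atlas M" and V: "(V, \<psi>) \<in> atlas N"
    by (auto simp: atlas_prod_manifold)
  let ?A = "\<theta> ` (W \<inter> f -` U)" and ?B = "\<theta> ` (W \<inter> g -` V)"
  note s = smooth_map_chart[OF f W U] smooth_map_chart[OF g W V]
  have o: "open (?A \<inter> ?B)"
    using s by (intro open_Int smooth_on_open)
  have "smooth_on (?A \<inter> ?B) (\<lambda>x. (\<phi> (f (inv_into W \<theta> x)), \<psi> (g (inv_into W \<theta> x))))"
    by (intro smooth_on_Pair smooth_on_subset[OF s(1) o] smooth_on_subset[OF s(2) o]) auto
  moreover have "?A \<inter> ?B = \<theta> ` (W \<inter> (\<lambda>x. (f x, g x)) -` Z)"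
  proof -
    \<comment> \<open>Images commute with this intersection because the chart
      \<open>\<theta>\<close> is injective on \<open>W\<close>.\<close>
    have "?A \<inter> ?B = \<theta> ` ((W \<inter> f -` U) \<inter> (W \<inter> g -` V))"
      by (rule inj_on_image_Int[OF chart_inj[OF K W], symmetric]) auto
    also have "(W \<inter> f -` U) \<inter> (W \<inter> g -` V) = W \<inter> (\<lambda>x. (f x, g x)) -` Z"
      by (auto simp: Z)
    finally show ?thesis .
  qed
  ultimately show "smooth_on (\<theta> ` (W \<inter> (\<lambda>x. (f x, g x)) -` Z))
      (\<lambda>x. \<zeta> (f (inv_into W \<theta> x), g (inv_into W \<theta> x)))"
    by (simp add: Z)
qed

text \<open>Between a product chart and a chart of \<open>M\<close>, \<open>fst\<close> becomes a
  linear projection followed by a transition map of \<open>M\<close>; the argument for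
  \<open>snd\<close> is symmetric.\<close>

lemma smooth_map_fst:
  assumes M: "smooth_manifold M" and N: "smooth_manifold N"
  shows "smooth_map (M \<times>\<^sub>M N) M fst"
proof (rule smooth_mapI)
  show "continuous_map (mtop (M \<times>\<^sub>M N)) (mtop M) fst"
    by (simp add: continuous_map_fst)
  fix W \<theta> U' \<phi>' assume "(W, \<theta>) \<in> atlas (M \<times>\<^sub>M N)" and U': "(U', \<phi>') \<in> atlas M"
  then obtain U \<phi> V \<psi> where W: "W = U \<times> V" "\<theta> = map_prod \<phi> \<psi>"
    and U: "(U, \<phi>) \<in> atlas M" and V: "(V, \<psi>) \<in> atlas N"
    by (auto simp: atlas_prod_manifold)
  let ?S = "\<phi> ` (U \<inter> U') \<times> \<psi> ` V"
  note s = chart_transition_smooth[OF M U U']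
  have o: "open ?S"
    by (intro open_Times smooth_on_open[OF s] chart_open_image[OF N V])
  have "smooth_on ?S (\<lambda>z. (\<phi>' \<circ> inv_into U \<phi>) (fst z))"
    by (rule smooth_on_compose[OF smooth_on_bounded_linear[OF o bounded_linear_fst] s]) auto
  then have "smooth_on ?S (\<lambda>x. \<phi>' (fst (inv_into W \<theta> x)))"
    unfolding W
    by (rule smooth_on_cong)
       (subst inv_into_map_prod[OF chart_inj[OF M U] chart_inj[OF N V]], auto)
  moreover have "\<theta> ` (W \<inter> fst -` U') = ?S"
  proof -
    have "W \<inter> fst -` U' = (U \<inter> U') \<times> V" by (auto simp: W)
    then show ?thesis by (simp add: W map_prod_image)
  qed
  ultimately show "smooth_on (\<theta> ` (W \<inter> fst -` U')) (\<lambda>x. \<phi>' (fst (inv_into W \<theta> x)))"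
    by simp
qed

lemma smooth_map_snd:
  assumes M: "smooth_manifold M" and N: "smooth_manifold N"
  shows "smooth_map (M \<times>\<^sub>M N) N snd"
proof (rule smooth_mapI)
  show "continuous_map (mtop (M \<times>\<^sub>M N)) (mtop N) snd"
    by (simp add: continuous_map_snd)
  fix W \<theta> V' \<psi>' assume "(W, \<theta>) \<in> atlas (M \<times>\<^sub>M N)" and V': "(V', \<psi>') \<in> atlas N"
  then obtain U \<phi> V \<psi> where W: "W = U \<times> V" "\<theta> = map_prod \<phi> \<psi>"
    and U: "(U, \<phi>) \<in> atlas M" and V: "(V, \<psi>) \<in> atlas N"
    by (auto simp: atlas_prod_manifold)
  let ?S = "\<phi> ` U \<times> \<psi> ` (V \<inter> V')"
  note s = chart_transition_smooth[OF N V V']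
  have o: "open ?S"
    by (intro open_Times smooth_on_open[OF s] chart_open_image[OF M U])
  have "smooth_on ?S (\<lambda>z. (\<psi>' \<circ> inv_into V \<psi>) (snd z))"
    by (rule smooth_on_compose[OF smooth_on_bounded_linear[OF o bounded_linear_snd] s]) auto
  then have "smooth_on ?S (\<lambda>x. \<psi>' (snd (inv_into W \<theta> x)))"
    unfolding W
    by (rule smooth_on_cong)
       (subst inv_into_map_prod[OF chart_inj[OF M U] chart_inj[OF N V]], auto)
  moreover have "\<theta> ` (W \<inter> snd -` V') = ?S"
  proof -
    have "W \<inter> snd -` V' = U \<times> (V \<inter> V')" by (auto simp: W)
    then show ?thesis by (simp add: W map_prod_image)
  qed
  ultimately show "smooth_on (\<theta> ` (W \<inter> snd -` V')) (\<lambda>x. \<psi>' (snd (inv_into W \<theta> x)))"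
    by simp
qed


section \<open>From principal bundles to semiheap bundles\<close>

text \<open>Stated for functions on an arbitrary manifold \<open>K\<close>, so that smoothness of a
  group expression follows its term structure.\<close>

lemma lie_group_smooth_mult:
  assumes G: "lie_group G L" and K: "smooth_manifold K"
    and f: "smooth_map K L f" and g: "smooth_map K L g"
  shows "smooth_map K L (\<lambda>x. f x \<otimes>\<^bsub>G\<^esub> g x)"
proof -
  have L: "smooth_manifold L" and m: "smooth_map (L \<times>\<^sub>M L) L (\<lambda>(x, y). x \<otimes>\<^bsub>G\<^esub> y)"
    using G by (auto simp: lie_group_def)
  show ?thesis
    using smooth_map_compose[OF K smooth_manifold_prod[OF L L] L smooth_map_Pair[OF K f g] m] by simp
qed

lemma lie_group_smooth_inv:
  assumes G: "lie_group G L" and K: "smooth_manifold K" and f: "smooth_map K L f"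
  shows "smooth_map K L (\<lambda>x. inv\<^bsub>G\<^esub> (f x))"
proof -
  have L: "smooth_manifold L" and i: "smooth_map L L (\<lambda>x. inv\<^bsub>G\<^esub> x)"
    using G by (auto simp: lie_group_def)
  show ?thesis by (rule smooth_map_compose[OF K L L f i])
qed

text \<open>All three expressions equal \<open>x1 x2^-1 x3 x4^-1 x5\<close>. The reversed order in
  the middle one is undone by inverting \<open>[x4, x3, x2]\<close>.\<close>

lemma (in group) group_bracket_para_assoc:
  assumes "x1 \<in> carrier G" "x2 \<in> carrier G" "x3 \<in> carrier G" "x4 \<in> carrier G" "x5 \<in> carrier G"
  shows "group_bracket G (group_bracket G x1 x2 x3) x4 x5 = group_bracket G x1 (group_bracket G x4 x3 x2) x5"
    and "group_bracket G x1 (group_bracket G x4 x3 x2) x5 = group_bracket G x1 x2 (group_bracket G x3 x4 x5)"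
  using assms by (simp_all add: group_bracket_def inv_mult_group m_assoc)

lemma lie_semiheap_group_bracket:
  assumes G: "lie_group G L"
  shows "lie_semiheap L (group_bracket G)"
proof -
  interpret group G using G by (simp add: lie_group_def)
  have L: "smooth_manifold L" and pts: "points L = carrier G"
    using G by (auto simp: lie_group_def)
  note LL = smooth_manifold_prod[OF L L]
  note LLL = smooth_manifold_prod[OF L LL]
  \<comment> \<open>The triple product nests to the right, so the second and third coordinates are
    projections of the \<open>snd\<close> component.\<close>
  note x = smooth_map_fst[OF L LL] and yz = smooth_map_snd[OF L LL]
  note y = smooth_map_compose[OF LLL LL L yz smooth_map_fst[OF L L]]
  note z = smooth_map_compose[OF LLL LL L yz smooth_map_snd[OF L L]]
  have "smooth_map (L \<times>\<^sub>M L \<times>\<^sub>M L) L (\<lambda>w. fst w \<otimes>\<^bsub>G\<^esub> inv\<^bsub>G\<^esub> (fst (snd w)) \<otimes>\<^bsub>G\<^esub> snd (snd w))"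
    by (intro lie_group_smooth_mult[OF G LLL] lie_group_smooth_inv[OF G LLL] x y z)
  then have "smooth_map (L \<times>\<^sub>M L \<times>\<^sub>M L) L (\<lambda>(x, y, z). group_bracket G x y z)"
    by (simp add: group_bracket_def case_prod_unfold)
  then show ?thesis
    using L group_bracket_para_assoc by (simp add: lie_semiheap_def pts)
qed

text \<open>Acting by \<open>x1^-1 x2\<close> and then by \<open>x3^-1 x4\<close> is acting by
  \<open>x1^-1 x2 x3^-1 x4\<close>, which is \<open>x1^-1 [x2, x3, x4]\<close>.\<close>

lemma semiheap_space_group_space:
  assumes act: "group_space G L N a"
  shows "semiheap_space L (group_bracket G) N (\<lambda>n g1 g2. a (inv\<^bsub>G\<^esub> g1 \<otimes>\<^bsub>G\<^esub> g2) n)"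
proof -
  have G: "lie_group G L" and N: "smooth_manifold N"
    and sm: "smooth_map (N \<times>\<^sub>M L) N (\<lambda>(n, g). a g n)"
    and comp: "\<And>n g h. n \<in> points N \<Longrightarrow> g \<in> carrier G \<Longrightarrow> h \<in> carrier G \<Longrightarrow>
      a h (a g n) = a (g \<otimes>\<^bsub>G\<^esub> h) n"
    using act by (auto simp: group_space_def)
  interpret group G using G by (simp add: lie_group_def)
  have L: "smooth_manifold L" and pts: "points L = carrier G"
    using G by (auto simp: lie_group_def)
  note LL = smooth_manifold_prod[OF L L]
  note NLL = smooth_manifold_prod[OF N LL] and NL = smooth_manifold_prod[OF N L]
  note n = smooth_map_fst[OF N LL] and xy = smooth_map_snd[OF N LL]
  note x = smooth_map_compose[OF NLL LL L xy smooth_map_fst[OF L L]]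
  note y = smooth_map_compose[OF NLL LL L xy smooth_map_snd[OF L L]]
  \<comment> \<open>The new action factors through this map, followed by the given action of the
    group.\<close>
  have "smooth_map (N \<times>\<^sub>M L \<times>\<^sub>M L) (N \<times>\<^sub>M L) (\<lambda>w. (fst w, inv\<^bsub>G\<^esub> (fst (snd w)) \<otimes>\<^bsub>G\<^esub> snd (snd w)))"
    by (intro smooth_map_Pair[OF NLL] lie_group_smooth_mult[OF G NLL]
        lie_group_smooth_inv[OF G NLL] n x y)
  from smooth_map_compose[OF NLL NL N this sm]
  have "smooth_map (N \<times>\<^sub>M L \<times>\<^sub>M L) N (\<lambda>(n, x, y). a (inv\<^bsub>G\<^esub> x \<otimes>\<^bsub>G\<^esub> y) n)"
    by (simp add: case_prod_unfold)
  then show ?thesis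
    using lie_semiheap_group_bracket[OF G] N
    by (auto simp: semiheap_space_def pts comp group_bracket_def m_assoc)
qed

theorem proposition3p7:
  fixes P :: "('p, 'e::finite_dim_inner) manifold"
    and M :: "('m, 'f::finite_dim_inner) manifold"
    and G :: "('g, 'z) monoid_scheme"
    and L :: "('g, 'h::finite_dim_inner) manifold"
    and \<pi> :: "'p \<Rightarrow> 'm"
    and a :: "'g \<Rightarrow> 'p \<Rightarrow> 'p"
  assumes "principal_bundle P M G L \<pi> a"
  shows "semiheap_bundle P M L (group_bracket G) \<pi> (\<lambda>p g1 g2. a (inv\<^bsub>G\<^esub> g1 \<otimes>\<^bsub>G\<^esub> g2) p)"
proof -
  let ?act = "\<lambda>p g1 g2. a (inv\<^bsub>G\<^esub> g1 \<otimes>\<^bsub>G\<^esub> g2) p"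
  have sp: "group_space G L P a" and base: "smooth_manifold M" "submersion P M \<pi>" "\<pi> ` points P = points M"
    and fib: "\<forall>p\<in>points P. \<forall>g\<in>carrier G. \<pi> (a g p) = \<pi> p"
    by (insert assms[unfolded principal_bundle_def], (elim conjE, assumption)+)
  have G: "lie_group G L" using sp by (simp add: group_space_def)
  interpret group G using G by (simp add: lie_group_def)
  have pts: "points L = carrier G" using G by (simp add: lie_group_def)
  let ?PU = "\<lambda>U. open_submanifold P (points P \<inter> \<pi> -` U)"
  let ?UG = "\<lambda>U. open_submanifold M U \<times>\<^sub>M L"
  obtain T where T: "(\<Union>(U, t)\<in>T. U) = points M"
    and "\<forall>(U, t)\<in>T. openin (mtop M) U \<and> diffeomorphism (?PU U) (?UG U) t \<and>
      group_equivariant G (?PU U) a (?UG U) (\<lambda>g (m, x). (m, x \<otimes>\<^bsub>G\<^esub> g)) t \<and>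
      (\<forall>p\<in>points (?PU U). fst (t p) = \<pi> p)"
    using assms unfolding principal_bundle_def Let_def by (elim conjE exE) (rule that)
  then have triv: "openin (mtop M) U \<and> diffeomorphism (?PU U) (?UG U) t \<and>
      group_equivariant G (?PU U) a (?UG U) (\<lambda>g (m, x). (m, x \<otimes>\<^bsub>G\<^esub> g)) t \<and>
      (\<forall>p\<in>points (?PU U). fst (t p) = \<pi> p)" if "(U, t) \<in> T" for U t
    using that by fast
  have "semiheap_equivariant L (?PU U) ?act (?UG U) (\<lambda>(m, x) x1 x2. (m, group_bracket G x x1 x2)) t"
    if "(U, t) \<in> T" for U t
    unfolding semiheap_equivariant_def pts
  proof (intro conjI ballI)
    have eq: "group_equivariant G (?PU U) a (?UG U) (\<lambda>g (m, x). (m, x \<otimes>\<^bsub>G\<^esub> g)) t"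
      using triv[OF that] by blast
    then show sm: "smooth_map (?PU U) (?UG U) t" by (simp add: group_equivariant_def)
    fix p x y assume p: "p \<in> points (?PU U)" and xy: "x \<in> carrier G" "y \<in> carrier G"
    obtain m z where mz: "t p = (m, z)" by (cases "t p")
    \<comment> \<open>Rebracketing \<open>z (x^-1 y)\<close> as \<open>(z x^-1) y\<close> requires
      \<open>z\<close> to be a group element; it is one because \<open>t\<close> maps into the
      product with \<open>L\<close>.\<close>
    have "z \<in> carrier G"
      using smooth_map_points[OF sm p] by (simp add: mz pts)
    moreover have "t (?act p x y) = (m, z \<otimes>\<^bsub>G\<^esub> (inv\<^bsub>G\<^esub> x \<otimes>\<^bsub>G\<^esub> y))"
      using eq p xy mz by (simp add: group_equivariant_def)
    ultimately show "t (?act p x y) = (case t p of (m, x') \<Rightarrow> \<lambda>x1 x2. (m, group_bracket G x' x1 x2)) x y"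
      using xy by (simp add: mz group_bracket_def m_assoc)
  qed
  then have "\<forall>(U, t)\<in>T. openin (mtop M) U \<and> diffeomorphism (?PU U) (?UG U) t \<and>
      semiheap_equivariant L (?PU U) ?act (?UG U) (\<lambda>(m, x) x1 x2. (m, group_bracket G x x1 x2)) t \<and>
      (\<forall>p\<in>points (?PU U). fst (t p) = \<pi> p)"
    using triv by blast
  \<comment> \<open>The cover and the trivialisations are reused unchanged. Invariance of
    \<open>\<pi>\<close> is the instance of \<open>fib\<close> at the group element
    \<open>x^-1 y\<close>.\<close>
  with T show ?thesis
    unfolding semiheap_bundle_def Let_def
    using semiheap_space_group_space[OF sp] base fib by (intro conjI exI[of _ T]) (simp_all add: pts)
qed

end
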